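(* Let $S_a$ be a fragment of $\lambda_{alg}^{=}$ and $S_\ell$ a fragment of $\lambda_{lin}^{=}$ such that for every $M\in S_a$, $(\overline M)~\lambda x\,x\in S_\ell$. For every closed term $M\in S_a$ and every value $V$: if $M\to^{=*}_{a\cup\beta}V$ (in the fragment $S_a$), then $(\overline M)~\lambda x\,x\to^{=*}_{\ell\cup\beta}\Phi(V)$ (in the fragment $S_\ell$).
   Context: Fix a ring of scalars (elements $\alpha,\beta$). Terms, values and base terms are given by: $M,N,L ::= V \mid (M)~N \mid \alpha.M \mid M+N$ (terms); $U,V,W ::= 0 \mid B \mid \alpha.V \mid V+W$ (values); $B ::= x \mid \lambda x\,M$ (base terms). Terms are taken up to renaming of bound variables; $M[x:=N]$ is capture-avoiding substitution. Below $V$ is a value and $B$ a base term. Rewrite rules: $(\beta_n)$ $(\lambda x\,M)~N\to M[x:=N]$. $(A)$ $(M+N)~L\to (M)~L+(N)~L$; $(\alpha.M)~N\to\alpha.(M)~N$; $(0)~M\to 0$. $(\beta_v)$ $(\lambda x\,M)~B\to M[x:=B]$. $(A_l)$ $(M+N)~V\to(M)~V+(N)~V$; $(\alpha.M)~V\to\alpha.(M)~V$; $(0)~V\to 0$. $(A_r)$ $(B)~(M+N)\to(B)~M+(B)~N$; $(B)~(\alpha.M)\to\alpha.(B)~M$; $(B)~0\to 0$. (Asso) $M+(N+L)\to(M+N)+L$ and $(M+N)+L\to M+(N+L)$. (Com) $M+N\to N+M$. $(F)$ $\alpha.M+\beta.M\to(\alpha+\beta).M$; $\alpha.M+M\to(\alpha+1).M$;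 $M+M\to(1+1).M$; $\alpha.(\beta.M)\to(\alpha\beta).M$. $(S)$ $\alpha.(M+N)\to\alpha.M+\alpha.N$; $1.M\to M$; $0.M\to 0$; $\alpha.0\to 0$; $0+M\to M$. Context rules $(\xi)$: from $M\to M'$ infer $(M)~N\to(M')~N$, $M+N\to M'+N$, $N+M\to N+M'$, $\alpha.M\to\alpha.M'$. Context rule $(\xi_{lin})$: from $M\to M'$ infer $(V)~M\to(V)~M'$ for $V$ a value. Let $L=\mathrm{Asso}\cup\mathrm{Com}\cup F\cup S$. Define: $\to_a$ generated by $A\cup L$ closed under $\xi$; $\to_\ell$ generated by $A_l\cup A_r\cup L$ closed under $\xi,\xi_{lin}$; $\to_{\beta_v}$ generated by $\beta_v$ closed under $\xi,\xi_{lin}$; $\to_{\beta_n}$ generated by $\beta_n$ closed under $\xi$. $R^{*}$ denotes reflexive-transitive closure. Set $\to_{\ell\cup\beta}:=\to_\ell\cup\to_{\beta_v}$ (language $\lambda_{lin}^{\to}$), $\to_{a\cup\beta}:=\to_a\cup\to_{\beta_n}$ (language $\lambda_{alg}^{\to}$). Fragments: a fragment of $\lambda_{lin}^{\to}$ (resp. $\lambda_{alg}^{\to}$) is a set $S$ of terms closed under $\to_{\ell\cup\beta}$ (resp. $\to_{a\cup\beta}$), with the rewrite relation restricted to $S$. A fragment of $\lambda_{lin}^{=}$ (resp. $\lambda_{alg}^{=}$) is a fragment $S$ of $\lambda_{lin}^{\to}$ (resp. $\lambda_{alg}^{\to}$) equipped with the restricted algebraic equality: $M\to^{=}_\ell N$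 holds in $S$ iff $M,N\in S$ and ($M\to_\ell N$ or $N\to_\ell M$) (resp. the same with $\to_a$); its reduction $\to^{=}_{\ell\cup\beta}$ (resp. $\to^{=}_{a\cup\beta}$) is this restricted equality union $\to_{\beta_v}$ (resp. $\to_{\beta_n}$). Translation (with $f,g,y$ fresh variables): $\overline{x}=x$; $\overline{0}=\lambda f\,(0)~f$; $\overline{\lambda x\,M}=\lambda f\,(f)~\lambda x\,\overline M$; $\overline{(M)~N}=\lambda f\,(\overline M)~\lambda g\,((g)~\overline N)~f$; $\overline{\alpha.M}=\lambda f\,(\alpha.\overline M)~f$; $\overline{M+N}=\lambda f\,(\overline M+\overline N)~f$. On values: $\Phi(x)=(x)~\lambda y\,y$, $\Phi(0)=0$, $\Phi(\lambda x\,M)=\lambda x\,\overline M$, $\Phi(\alpha.V)=\alpha.\Phi(V)$, $\Phi(V+W)=\Phi(V)+\Phi(W)$. *)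

theory Defs
  imports Main
begin

text \<open>Terms up to renaming of bound variables are represented by de Bruijn terms; under
  \<open>d\<close> binders, index \<open>i + d\<close> denotes the free variable \<open>i\<close>. Scalars have sort
  \<open>{ring, monoid_mult}\<close>, i.e. rings with unit in which \<open>0 = 1\<close> is not excluded
  and multiplication need not be commutative.\<close>

datatype 'a trm =
    Var nat
  | Lam "'a trm"
  | App "'a trm" "'a trm"
  | Zero
  | Scal 'a "'a trm"
  | Plus "'a trm" "'a trm"

fun is_base :: "'a trm \<Rightarrow> bool" where
  "is_base (Var i) = True"
| "is_base (Lam M) = True"
| "is_base _ = False"

fun is_value :: "'a trm \<Rightarrow> bool" where
  "is_value (Var i) = True"
| "is_value (Lam M) = True"
| "is_value (App M N) = False"
| "is_value Zero = True"
| "is_value (Scal a M) = is_value M"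
| "is_value (Plus M N) = (is_value M \<and> is_value N)"

primrec fv :: "'a trm \<Rightarrow> nat set" where
  "fv (Var i) = {i}"
| "fv (Lam M) = {i. Suc i \<in> fv M}"
| "fv (App M N) = fv M \<union> fv N"
| "fv Zero = {}"
| "fv (Scal a M) = fv M"
| "fv (Plus M N) = fv M \<union> fv N"

definition closed_trm :: "'a trm \<Rightarrow> bool" where
  "closed_trm M \<longleftrightarrow> fv M = {}"

text \<open>\<open>lift k M\<close> increments all indices \<open>\<ge> k\<close>; \<open>subst k N M\<close> replaces index \<open>k\<close> by
  \<open>N\<close> in \<open>M\<close> and decrements all larger indices, so that the contractum of
  \<open>App (Lam M) N\<close> is \<open>subst 0 N M\<close>.\<close>

primrec lift :: "nat \<Rightarrow> 'a trm \<Rightarrow> 'a trm" where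
  "lift k (Var i) = (if i < k then Var i else Var (Suc i))"
| "lift k (Lam M) = Lam (lift (Suc k) M)"
| "lift k (App M N) = App (lift k M) (lift k N)"
| "lift k Zero = Zero"
| "lift k (Scal a M) = Scal a (lift k M)"
| "lift k (Plus M N) = Plus (lift k M) (lift k N)"

primrec subst :: "nat \<Rightarrow> 'a trm \<Rightarrow> 'a trm \<Rightarrow> 'a trm" where
  "subst k N (Var i) = (if k < i then Var (i - 1) else if i = k then N else Var i)"
| "subst k N (Lam M) = Lam (subst (Suc k) (lift 0 N) M)"
| "subst k N (App M L) = App (subst k N M) (subst k N L)"
| "subst k N Zero = Zero"
| "subst k N (Scal a M) = Scal a (subst k N M)"
| "subst k N (Plus M L) = Plus (subst k N M) (subst k N L)"

subsection \<open>Rewrite rules\<close>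

inductive rule_beta_n :: "'a trm \<Rightarrow> 'a trm \<Rightarrow> bool" where
  "rule_beta_n (App (Lam M) N) (subst 0 N M)"

inductive rule_beta_v :: "'a trm \<Rightarrow> 'a trm \<Rightarrow> bool" where
  "is_base B \<Longrightarrow> rule_beta_v (App (Lam M) B) (subst 0 B M)"

inductive rule_A :: "'a trm \<Rightarrow> 'a trm \<Rightarrow> bool" where
  "rule_A (App (Plus M N) L) (Plus (App M L) (App N L))"
| "rule_A (App (Scal a M) N) (Scal a (App M N))"
| "rule_A (App Zero M) Zero"

inductive rule_Al :: "'a trm \<Rightarrow> 'a trm \<Rightarrow> bool" where
  "is_value V \<Longrightarrow> rule_Al (App (Plus M N) V) (Plus (App M V) (App N V))"
| "is_value V \<Longrightarrow> rule_Al (App (Scal a M) V) (Scal a (App M V))"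
| "is_value V \<Longrightarrow> rule_Al (App Zero V) Zero"

inductive rule_Ar :: "'a trm \<Rightarrow> 'a trm \<Rightarrow> bool" where
  "is_base B \<Longrightarrow> rule_Ar (App B (Plus M N)) (Plus (App B M) (App B N))"
| "is_base B \<Longrightarrow> rule_Ar (App B (Scal a M)) (Scal a (App B M))"
| "is_base B \<Longrightarrow> rule_Ar (App B Zero) Zero"

inductive rule_Asso :: "'a trm \<Rightarrow> 'a trm \<Rightarrow> bool" where
  "rule_Asso (Plus M (Plus N L)) (Plus (Plus M N) L)"
| "rule_Asso (Plus (Plus M N) L) (Plus M (Plus N L))"

inductive rule_Com :: "'a trm \<Rightarrow> 'a trm \<Rightarrow> bool" where
  "rule_Com (Plus M N) (Plus N M)"

inductive rule_F :: "'a::{ring,monoid_mult} trm \<Rightarrow> 'a trm \<Rightarrow> bool" where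
  "rule_F (Plus (Scal a M) (Scal b M)) (Scal (a + b) M)"
| "rule_F (Plus (Scal a M) M) (Scal (a + 1) M)"
| "rule_F (Plus M M) (Scal (1 + 1) M)"
| "rule_F (Scal a (Scal b M)) (Scal (a * b) M)"

inductive rule_S :: "'a::{ring,monoid_mult} trm \<Rightarrow> 'a trm \<Rightarrow> bool" where
  "rule_S (Scal a (Plus M N)) (Plus (Scal a M) (Scal a N))"
| "rule_S (Scal 1 M) M"
| "rule_S (Scal 0 M) Zero"
| "rule_S (Scal a Zero) Zero"
| "rule_S (Plus Zero M) M"

definition rule_L :: "'a::{ring,monoid_mult} trm \<Rightarrow> 'a trm \<Rightarrow> bool" where
  "rule_L = sup (sup rule_Asso rule_Com) (sup rule_F rule_S)"

subsection \<open>Context closures and reductions\<close>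

inductive ctx_xi :: "('a trm \<Rightarrow> 'a trm \<Rightarrow> bool) \<Rightarrow> 'a trm \<Rightarrow> 'a trm \<Rightarrow> bool"
  for R where
  base: "R M M' \<Longrightarrow> ctx_xi R M M'"
| app_left: "ctx_xi R M M' \<Longrightarrow> ctx_xi R (App M N) (App M' N)"
| plus_left: "ctx_xi R M M' \<Longrightarrow> ctx_xi R (Plus M N) (Plus M' N)"
| plus_right: "ctx_xi R M M' \<Longrightarrow> ctx_xi R (Plus N M) (Plus N M')"
| scal: "ctx_xi R M M' \<Longrightarrow> ctx_xi R (Scal a M) (Scal a M')"

inductive ctx_xi_lin :: "('a trm \<Rightarrow> 'a trm \<Rightarrow> bool) \<Rightarrow> 'a trm \<Rightarrow> 'a trm \<Rightarrow> bool"
  for R where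
  base: "R M M' \<Longrightarrow> ctx_xi_lin R M M'"
| app_left: "ctx_xi_lin R M M' \<Longrightarrow> ctx_xi_lin R (App M N) (App M' N)"
| plus_left: "ctx_xi_lin R M M' \<Longrightarrow> ctx_xi_lin R (Plus M N) (Plus M' N)"
| plus_right: "ctx_xi_lin R M M' \<Longrightarrow> ctx_xi_lin R (Plus N M) (Plus N M')"
| scal: "ctx_xi_lin R M M' \<Longrightarrow> ctx_xi_lin R (Scal a M) (Scal a M')"
| app_right: "is_value V \<Longrightarrow> ctx_xi_lin R M M' \<Longrightarrow> ctx_xi_lin R (App V M) (App V M')"

definition red_a :: "'a::{ring,monoid_mult} trm \<Rightarrow> 'a trm \<Rightarrow> bool" where
  "red_a = ctx_xi (sup rule_A rule_L)"

definition red_l :: "'a::{ring,monoid_mult} trm \<Rightarrow> 'a trm \<Rightarrow> bool" where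
  "red_l = ctx_xi_lin (sup (sup rule_Al rule_Ar) rule_L)"

definition red_beta_n :: "'a trm \<Rightarrow> 'a trm \<Rightarrow> bool" where
  "red_beta_n = ctx_xi rule_beta_n"

definition red_beta_v :: "'a trm \<Rightarrow> 'a trm \<Rightarrow> bool" where
  "red_beta_v = ctx_xi_lin rule_beta_v"

definition red_alg :: "'a::{ring,monoid_mult} trm \<Rightarrow> 'a trm \<Rightarrow> bool" where
  "red_alg = sup red_a red_beta_n"

definition red_lin :: "'a::{ring,monoid_mult} trm \<Rightarrow> 'a trm \<Rightarrow> bool" where
  "red_lin = sup red_l red_beta_v"

subsection \<open>Fragments with algebraic equality\<close>

definition closed_under :: "('a trm \<Rightarrow> 'a trm \<Rightarrow> bool) \<Rightarrow> 'a trm set \<Rightarrow> bool" where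
  "closed_under R S \<longleftrightarrow> (\<forall>M\<in>S. \<forall>N. R M N \<longrightarrow> N \<in> S)"

definition restricted_to :: "'a trm set \<Rightarrow> ('a trm \<Rightarrow> 'a trm \<Rightarrow> bool) \<Rightarrow> 'a trm \<Rightarrow> 'a trm \<Rightarrow> bool"
  where "restricted_to S R M N \<longleftrightarrow> M \<in> S \<and> N \<in> S \<and> R M N"

definition fragment_alg :: "'a::{ring,monoid_mult} trm set \<Rightarrow> bool" where
  "fragment_alg S \<longleftrightarrow> closed_under red_alg S"

definition fragment_lin :: "'a::{ring,monoid_mult} trm set \<Rightarrow> bool" where
  "fragment_lin S \<longleftrightarrow> closed_under red_lin S"

definition eq_a :: "'a::{ring,monoid_mult} trm set \<Rightarrow> 'a trm \<Rightarrow> 'a trm \<Rightarrow> bool" where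
  "eq_a S M N \<longleftrightarrow> M \<in> S \<and> N \<in> S \<and> (red_a M N \<or> red_a N M)"

definition eq_l :: "'a::{ring,monoid_mult} trm set \<Rightarrow> 'a trm \<Rightarrow> 'a trm \<Rightarrow> bool" where
  "eq_l S M N \<longleftrightarrow> M \<in> S \<and> N \<in> S \<and> (red_l M N \<or> red_l N M)"

definition red_eq_alg :: "'a::{ring,monoid_mult} trm set \<Rightarrow> 'a trm \<Rightarrow> 'a trm \<Rightarrow> bool" where
  "red_eq_alg S = sup (eq_a S) (restricted_to S red_beta_n)"

definition red_eq_lin :: "'a::{ring,monoid_mult} trm set \<Rightarrow> 'a trm \<Rightarrow> 'a trm \<Rightarrow> bool" where
  "red_eq_lin S = sup (eq_l S) (restricted_to S red_beta_v)"

subsection \<open>Translation\<close>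

text \<open>Freshness of \<open>f\<close> and \<open>g\<close> is expressed by lifting the translated subterms over the new
  binders. In the application clause, \<open>Var 0\<close> is \<open>g\<close> and \<open>Var 1\<close> is \<open>f\<close>.\<close>

primrec cps :: "'a trm \<Rightarrow> 'a trm" where
  "cps (Var i) = Var i"
| "cps Zero = Lam (App Zero (Var 0))"
| "cps (Lam M) = Lam (App (Var 0) (lift 0 (Lam (cps M))))"
| "cps (App M N) =
     Lam (App (lift 0 (cps M)) (Lam (App (App (Var 0) (lift 0 (lift 0 (cps N)))) (Var 1))))"
| "cps (Scal a M) = Lam (App (Scal a (lift 0 (cps M))) (Var 0))"
| "cps (Plus M N) = Lam (App (Plus (lift 0 (cps M)) (lift 0 (cps N))) (Var 0))"

text \<open>Meaningful on values only: there is no equation for applications.\<close>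

fun Phi :: "'a trm \<Rightarrow> 'a trm" where
  "Phi (Var i) = App (Var i) (Lam (Var 0))"
| "Phi Zero = Zero"
| "Phi (Lam M) = Lam (cps M)"
| "Phi (Scal a V) = Scal a (Phi V)"
| "Phi (Plus V W) = Plus (Phi V) (Phi W)"

end

theory Submission
  imports Defs
begin

text \<open>The proof evaluates the administrative redexes of a translated term ahead of time: for a
  base term \<open>K\<close>, \<open>(cps M) K\<close> reduces to a term \<open>colon M K\<close> that is homomorphic in the algebraic
  structure of \<open>M\<close> and pushes the arguments of an application into the continuation. The
  \<open>A\<close> rules then become identities and every other algebraic step from \<open>M\<close> to \<open>N\<close> becomes exactly
  one algebraic step from \<open>colon M K\<close> to \<open>colon N K\<close>, without any \<open>\<beta>\<close>-step, so that it can be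
  reversed. Fragment membership of \<open>colon N K\<close> with \<open>K\<close> the identity follows from that of
  \<open>(cps N) K\<close>, because fragments are closed under reduction.\<close>

lemma lift_lift: "i \<le> k \<Longrightarrow> lift (Suc k) (lift i M) = lift i (lift k M)"
  by (induction M arbitrary: i k) auto

lemma subst_lift [simp]: "subst k N (lift k M) = M"
  by (induction M arbitrary: k N) auto

lemma lift_subst:
  "i \<le> k \<Longrightarrow> lift i (subst k N M) = subst (Suc k) (lift i N) (lift i M)"
proof (induction M arbitrary: i k N)
  case (Var j)
  then show ?case by (cases j) auto
qed (auto simp: lift_lift)

lemma cps_lift: "cps (lift k M) = lift k (cps M)"
  by (induction M arbitrary: k) (auto simp: lift_lift)

lemma cps_subst: "cps (subst k N M) = subst k (cps N) (cps M)"
  by (induction M arbitrary: k N) (auto simp: lift_subst cps_lift lift_lift)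

text \<open>The continuation \<lambda>g. ((g) \<open>cps N\<close>) \<open>K\<close> that
  \<open>cps (App M N)\<close>, applied to \<open>K\<close>, hands to \<open>cps M\<close>.\<close>

definition arg_cont :: "'a trm \<Rightarrow> 'a trm \<Rightarrow> 'a trm" where
  "arg_cont N K = Lam (App (App (Var 0) (lift 0 (cps N))) (lift 0 K))"

text \<open>Plotkin's colon translation. A variable stands for a computation still awaiting its
  continuation, hence \<open>App (Var i) K\<close>; an abstraction is a result and is handed to
  \<open>K\<close>.\<close>

primrec colon :: "'a trm \<Rightarrow> 'a trm \<Rightarrow> 'a trm" where
  "colon (Var i) K = App (Var i) K"
| "colon (Lam M) K = App K (Lam (cps M))"
| "colon (App M N) K = colon M (arg_cont N K)"
| "colon Zero K = Zero"
| "colon (Scal a M) K = Scal a (colon M K)"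
| "colon (Plus M N) K = Plus (colon M K) (colon N K)"

lemma is_base_arg_cont [simp]: "is_base (arg_cont N K)"
  by (simp add: arg_cont_def)

text \<open>This lets \<open>rule_beta_v\<close> simulate \<open>rule_beta_n\<close>: a translated
  argument is a variable or an abstraction, however complex its source.\<close>

lemma is_base_cps: "is_base (cps M)"
  by (cases M) auto

lemma is_value_if_is_base: "is_base K \<Longrightarrow> is_value K"
  by (cases K) auto

lemma red_lin_app_left: "red_lin M M' \<Longrightarrow> red_lin (App M N) (App M' N)"
  by (auto simp: red_lin_def red_l_def red_beta_v_def intro: ctx_xi_lin.app_left)

lemma red_lin_plus_left: "red_lin M M' \<Longrightarrow> red_lin (Plus M N) (Plus M' N)"
  by (auto simp: red_lin_def red_l_def red_beta_v_def intro: ctx_xi_lin.plus_left)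

lemma red_lin_plus_right: "red_lin M M' \<Longrightarrow> red_lin (Plus N M) (Plus N M')"
  by (auto simp: red_lin_def red_l_def red_beta_v_def intro: ctx_xi_lin.plus_right)

lemma red_lin_scal: "red_lin M M' \<Longrightarrow> red_lin (Scal a M) (Scal a M')"
  by (auto simp: red_lin_def red_l_def red_beta_v_def intro: ctx_xi_lin.scal)

lemma red_lin_rtrancl_plus:
  assumes "red_lin\<^sup>*\<^sup>* M M'" and "red_lin\<^sup>*\<^sup>* N N'"
  shows "red_lin\<^sup>*\<^sup>* (Plus M N) (Plus M' N')"
proof -
  from assms(1) have "red_lin\<^sup>*\<^sup>* (Plus M N) (Plus M' N)"
    by induction (auto intro: rtranclp.rtrancl_into_rtrancl red_lin_plus_left)
  moreover from assms(2) have "red_lin\<^sup>*\<^sup>* (Plus M' N) (Plus M' N')"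
    by induction (auto intro: rtranclp.rtrancl_into_rtrancl red_lin_plus_right)
  ultimately show ?thesis by (rule rtranclp_trans)
qed

lemma red_lin_rtrancl_scal: "red_lin\<^sup>*\<^sup>* M M' \<Longrightarrow> red_lin\<^sup>*\<^sup>* (Scal a M) (Scal a M')"
  by (induction rule: rtranclp_induct)
    (auto intro: rtranclp.rtrancl_into_rtrancl red_lin_scal)

lemma red_lin_beta: "is_base B \<Longrightarrow> red_lin (App (Lam M) B) (subst 0 B M)"
  by (auto simp: red_lin_def red_beta_v_def intro: ctx_xi_lin.base rule_beta_v.intros)

lemma red_lin_Al: "rule_Al M N \<Longrightarrow> red_lin M N"
  by (auto simp: red_lin_def red_l_def intro: ctx_xi_lin.base)

text \<open>A base \<open>K\<close> can be consumed by \<open>rule_beta_v\<close> and, being a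
  value, be distributed over sums by \<open>rule_Al\<close>. \<open>K\<close> varies because an
  application passes \<open>arg_cont N K\<close> to its function part.\<close>

lemma cps_red_lin_colon:
  fixes M :: "'a::{ring,monoid_mult} trm"
  assumes "is_base K"
  shows "red_lin\<^sup>*\<^sup>* (App (cps M) K) (colon M K)"
  using assms
proof (induction M arbitrary: K)
  case (Lam M)
  have "red_lin (App (cps (Lam M)) K) (colon (Lam M) K)"
    using red_lin_beta[OF Lam.prems, of "App (Var 0) (lift 0 (Lam (cps M)))"]
    \<comment> \<open>\<open>lift 0 (Lam (cps M))\<close> must stay folded for
      \<open>subst_lift\<close> to cancel it.\<close>
    by (simp del: lift.simps)
  then show ?case by blast
next
  case (App M N)
  have "red_lin (App (cps (App M N)) K) (App (cps M) (arg_cont N K))"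
    using red_lin_beta[OF App.prems,
        of "App (lift 0 (cps M)) (Lam (App (App (Var 0) (lift 0 (lift 0 (cps N)))) (Var 1)))"]
    \<comment> \<open>Read backwards, \<open>lift_subst\<close> moves the substitution below a lift,
      where \<open>subst_lift\<close> cancels it.\<close>
    by (simp add: arg_cont_def flip: lift_subst)
  moreover have "red_lin\<^sup>*\<^sup>* (App (cps M) (arg_cont N K)) (colon (App M N) K)"
    using App.IH(1)[of "arg_cont N K"] by simp
  ultimately show ?case by (rule converse_rtranclp_into_rtranclp)
next
  case Zero
  have "red_lin (App (cps Zero) K) (App Zero K)"
    using red_lin_beta[OF Zero, of "App Zero (Var 0)"] by simp
  moreover have "red_lin (App Zero K) Zero"
    using Zero by (auto intro: red_lin_Al rule_Al.intros is_value_if_is_base)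
  ultimately show ?case by (simp add: rtranclp.rtrancl_into_rtrancl)
next
  case (Scal a M)
  have "red_lin (App (cps (Scal a M)) K) (App (Scal a (cps M)) K)"
    using red_lin_beta[OF Scal.prems, of "App (Scal a (lift 0 (cps M))) (Var 0)"] by simp
  moreover have "red_lin (App (Scal a (cps M)) K) (Scal a (App (cps M) K))"
    using Scal.prems by (auto intro: red_lin_Al rule_Al.intros is_value_if_is_base)
  moreover have "red_lin\<^sup>*\<^sup>* (Scal a (App (cps M) K)) (colon (Scal a M) K)"
    using Scal by (simp add: red_lin_rtrancl_scal)
  ultimately show ?case by (meson converse_rtranclp_into_rtranclp)
next
  case (Plus M N)
  have "red_lin (App (cps (Plus M N)) K) (App (Plus (cps M) (cps N)) K)"
    using red_lin_beta[OF Plus.prems,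
        of "App (Plus (lift 0 (cps M)) (lift 0 (cps N))) (Var 0)"] by simp
  moreover have "red_lin (App (Plus (cps M) (cps N)) K) (Plus (App (cps M) K) (App (cps N) K))"
    using Plus.prems by (auto intro: red_lin_Al rule_Al.intros is_value_if_is_base)
  moreover have "red_lin\<^sup>*\<^sup>* (Plus (App (cps M) K) (App (cps N) K)) (colon (Plus M N) K)"
    using Plus by (simp add: red_lin_rtrancl_plus)
  ultimately show ?case by (meson converse_rtranclp_into_rtranclp)
qed simp

text \<open>\<open>rule_L\<close> only inspects sums, scalars and zero, which \<open>colon\<close>
  preserves, and repeated metavariables receive the same \<open>K\<close>.\<close>

lemma rule_L_colon: "rule_L M N \<Longrightarrow> rule_L (colon M K) (colon N K)"
  by (auto simp: rule_L_def elim!: rule_Asso.cases rule_Com.cases rule_F.cases rule_S.cases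
      intro: rule_Asso.intros rule_Com.intros rule_F.intros rule_S.intros)

lemma rule_A_colon: "rule_A M N \<Longrightarrow> colon M K = colon N K"
  by (auto elim: rule_A.cases)

lemma red_a_colon:
  assumes "red_a M N"
  shows "red_l\<^sup>=\<^sup>= (colon M K) (colon N K)"
  using assms unfolding red_a_def red_l_def
proof (induction arbitrary: K rule: ctx_xi.induct)
  case (base M M')
  then show ?case
    by (auto dest: rule_A_colon intro: ctx_xi_lin.base rule_L_colon)
next
  case (app_left M M' N)
  \<comment> \<open>The argument is absorbed into the continuation, so this is the hypothesis at
    \<open>arg_cont N K\<close>.\<close>
  then show ?case by simp
next
  case (plus_left M M' N)
  from plus_left.IH[of K] show ?case by (auto intro: ctx_xi_lin.plus_left)
next
  case (plus_right M M' N)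
  from plus_right.IH[of K] show ?case by (auto intro: ctx_xi_lin.plus_right)
next
  case (scal M M' a)
  from scal.IH[of K] show ?case by (auto intro: ctx_xi_lin.scal)
qed

lemma red_beta_n_colon:
  fixes M N :: "'a::{ring,monoid_mult} trm"
  assumes "red_beta_n M N" and "is_base K"
  shows "red_lin\<^sup>*\<^sup>* (colon M K) (colon N K)"
  using assms unfolding red_beta_n_def
proof (induction arbitrary: K rule: ctx_xi.induct)
  case (base R R')
  then obtain M N where R: "R = App (Lam M) N" and R': "R' = subst 0 N M"
    by (auto elim: rule_beta_n.cases)
  \<comment> \<open>The continuation \<open>arg_cont N K\<close> receives the translated abstraction
    and applies it to \<open>cps N\<close>, with \<open>K\<close> left outside.\<close>
  have "red_lin (colon R K) (App (App (Lam (cps M)) (cps N)) K)"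
    using red_lin_beta[of "Lam (cps M)" "App (App (Var 0) (lift 0 (cps N))) (lift 0 K)"]
    by (simp add: R arg_cont_def)
  moreover have "red_lin (App (App (Lam (cps M)) (cps N)) K) (App (cps R') K)"
    unfolding R' cps_subst by (intro red_lin_app_left red_lin_beta is_base_cps)
  moreover have "red_lin\<^sup>*\<^sup>* (App (cps R') K) (colon R' K)"
    using base.prems by (rule cps_red_lin_colon)
  ultimately show ?case by (meson converse_rtranclp_into_rtranclp)
next
  case (app_left M M' N)
  then show ?case by simp
qed (simp_all add: red_lin_rtrancl_plus red_lin_rtrancl_scal)

text \<open>\<open>Phi\<close> leaves a variable applied to the identity, exactly as
  \<open>colon\<close> does; only abstractions need a step, in which the identity returns its
  argument.\<close>

lemma colon_red_lin_Phi:
  fixes V :: "'a::{ring,monoid_mult} trm"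
  shows "is_value V \<Longrightarrow> red_lin\<^sup>*\<^sup>* (colon V (Lam (Var 0))) (Phi V)"
proof (induction V)
  case (Lam M)
  show ?case using red_lin_beta[of "Lam (cps M)" "Var 0"] by auto
qed (simp_all add: red_lin_rtrancl_plus red_lin_rtrancl_scal)

lemma red_lin_rtrancl_fragment:
  assumes "fragment_lin S" and "M \<in> S" and "red_lin\<^sup>*\<^sup>* M N"
  shows "N \<in> S \<and> (red_eq_lin S)\<^sup>*\<^sup>* M N"
  using assms(3)
proof (induction rule: rtranclp_induct)
  case base
  show ?case using assms(2) by simp
next
  case (step N L)
  then have "L \<in> S"
    using assms(1) by (auto simp: fragment_lin_def closed_under_def)
  with step have "red_eq_lin S N L"
    by (auto simp: red_eq_lin_def eq_l_def restricted_to_def red_lin_def)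
  with step \<open>L \<in> S\<close> show ?case by auto
qed

text \<open>An algebraic equality may run against the rewriting, where closure of \<open>Sl\<close>
  gives nothing; \<open>colon_in\<close> puts both endpoints in \<open>Sl\<close> instead.\<close>

lemma red_eq_alg_colon:
  assumes "red_eq_alg Sa M N" and "fragment_lin Sl" and "is_base K"
    and colon_in: "\<And>N. N \<in> Sa \<Longrightarrow> colon N K \<in> Sl"
  shows "(red_eq_lin Sl)\<^sup>*\<^sup>* (colon M K) (colon N K)"
proof -
  from assms(1) have in_Sa: "M \<in> Sa" "N \<in> Sa"
    by (auto simp: red_eq_alg_def eq_a_def restricted_to_def)
  from assms(1) consider "red_a M N \<or> red_a N M" | "red_beta_n M N"
    by (auto simp: red_eq_alg_def eq_a_def restricted_to_def)
  then show ?thesis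
  proof cases
    case 1
    then have "colon M K = colon N K \<or> eq_l Sl (colon M K) (colon N K)"
      using red_a_colon[of M N K] red_a_colon[of N M K] in_Sa
      by (auto simp: eq_l_def colon_in)
    then show ?thesis by (auto simp: red_eq_lin_def)
  next
    case 2
    then show ?thesis
      using red_lin_rtrancl_fragment[OF assms(2) colon_in[OF in_Sa(1)]]
        red_beta_n_colon[OF _ assms(3)] by blast
  qed
qed

theorem theorem9:
  fixes Sa Sl :: "'a::{ring,monoid_mult} trm set" and M V :: "'a trm"
  assumes "fragment_alg Sa"
    and "fragment_lin Sl"
    and "\<forall>N\<in>Sa. App (cps N) (Lam (Var 0)) \<in> Sl"
    and "M \<in> Sa"
    and "closed_trm M"
    and "is_value V"
    and "(red_eq_alg Sa)\<^sup>*\<^sup>* M V"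
  shows "(red_eq_lin Sl)\<^sup>*\<^sup>* (App (cps M) (Lam (Var 0))) (Phi V)"
proof -
  let ?I = "Lam (Var 0)"
  have cps_colon: "colon N ?I \<in> Sl \<and> (red_eq_lin Sl)\<^sup>*\<^sup>* (App (cps N) ?I) (colon N ?I)"
    if "N \<in> Sa" for N
    using red_lin_rtrancl_fragment[OF assms(2)] cps_red_lin_colon[of ?I N] assms(3) that by auto
  \<comment> \<open>Membership of \<open>V\<close> is carried along so that the final reduction to
    \<open>Phi V\<close> starts inside \<open>Sl\<close>.\<close>
  have "V \<in> Sa \<and> (red_eq_lin Sl)\<^sup>*\<^sup>* (colon M ?I) (colon V ?I)"
    using assms(7)
  proof (induction rule: rtranclp_induct)
    case base
    show ?case using assms(4) by simp
  next
    case (step N L)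
    from step.hyps(2) have "L \<in> Sa"
      by (auto simp: red_eq_alg_def eq_a_def restricted_to_def)
    moreover have "(red_eq_lin Sl)\<^sup>*\<^sup>* (colon N ?I) (colon L ?I)"
      using red_eq_alg_colon[OF step.hyps(2) assms(2)] cps_colon by simp
    ultimately show ?case using step.IH by auto
  qed
  moreover from this have "(red_eq_lin Sl)\<^sup>*\<^sup>* (colon V ?I) (Phi V)"
    using red_lin_rtrancl_fragment[OF assms(2)] colon_red_lin_Phi[OF assms(6)] cps_colon by blast
  ultimately show ?thesis using cps_colon[OF assms(4)] by auto
qed

end
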